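(* Let $m$ be even, let $\mathcal{C}\in T(m,n)$, $\mathbf{b}\in\mathbb{R}^n$, let $\mathcal{D}\in T(m,n)$ be a diagonal tensor whose diagonal elements are each $1$ or $-1$, and let $\mathcal{A}=\mathcal{C}\mathcal{D}$. If the system $$(\mathcal{C}-\mathcal{I})\mathbf{z}^{m-1}=\mathbf{b},\quad \mathbf{z}\ge\mathbf{0}$$ has a solution $\mathbf{z}\in\mathbb{R}^n$, then the tensor absolute value equation $$\mathcal{A}\mathbf{x}^{m-1}-|\mathbf{x}|^{[m-1]}=\mathbf{b}$$ also has a solution $\mathbf{x}\in\mathbb{R}^n$.
   Context: All tensors are real, and $m\ge 2$. $T(m,n)$ is the set of real $m$th-order $n$-dimensional tensors $\mathcal{A}=(a_{i_1i_2\ldots i_m})$, $1\le i_1,\ldots,i_m\le n$. For $\mathbf{x}\in\mathbb{R}^n$, $\mathcal{A}\mathbf{x}^{m-1}\in\mathbb{R}^n$ has components $(\mathcal{A}\mathbf{x}^{m-1})_i=\sum_{i_2,\ldots,i_m=1}^n a_{ii_2\ldots i_m}x_{i_2}\cdots x_{i_m}$, and $|\mathbf{x}|^{[m-1]}=(|x_1|^{m-1},\ldots,|x_n|^{m-1})^T$. Vector inequalities are componentwise. $\mathcal{I}\in T(m,n)$ is the unit tensor, with entries $1$ if $i_1=\cdots=i_m$ and $0$ otherwise. A tensor is diagonal if all entries other than the diagonal ones (those with $i_1=\cdots=i_m$) vanish. For $m$ even, the product of $\mathcal{C}=(c_{i_1\ldots i_m})\in T(m,n)$ with a diagonal tensor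 $\mathcal{B}\in T(m,n)$ with diagonal elements $b_{i\ldots i}$ is the tensor $\mathcal{C}\mathcal{B}=(a_{i_1\ldots i_m})\in T(m,n)$ with $$a_{i_1i_2\ldots i_m}=c_{i_1i_2\ldots i_m}(b_{i_2\ldots i_2})^{\frac{1}{m-1}}\cdots(b_{i_m\ldots i_m})^{\frac{1}{m-1}},$$ where $t^{1/(m-1)}$ is the real $(m-1)$-th root ($m-1$ is odd). *)

theory Defs
  imports "HOL-Analysis.Analysis"
begin

text \<open>
  A real tensor of order \<open>m\<close> and dimension \<open>n = CARD('n)\<close> is a function on index lists
  \<open>[i\<^sub>1, \<dots>, i\<^sub>m]\<close>, set to 0 on lists of any other length, so that function equality and
  pointwise subtraction on \<open>tensors m\<close> are equality and subtraction of tensors.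
\<close>

type_synonym 'n tensor = "'n list \<Rightarrow> real"

definition tensors :: "nat \<Rightarrow> 'n::finite tensor set" where
  "tensors m = {A. \<forall>js. length js \<noteq> m \<longrightarrow> A js = 0}"

text \<open>The vector \<open>A x\<^sup>m\<^sup>-\<^sup>1\<close>; the list \<open>js\<close> is \<open>[i\<^sub>2, \<dots>, i\<^sub>m]\<close>.\<close>

definition tensor_apply :: "nat \<Rightarrow> 'n::finite tensor \<Rightarrow> real ^ 'n \<Rightarrow> real ^ 'n" where
  "tensor_apply m A x =
     (\<chi> i. \<Sum>js | length js = m - 1. A (i # js) * (\<Prod>j\<leftarrow>js. x $ j))"

definition abs_pow_vec :: "nat \<Rightarrow> real ^ 'n \<Rightarrow> real ^ 'n::finite" where
  "abs_pow_vec k x = (\<chi> i. \<bar>x $ i\<bar> ^ k)"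

definition unit_tensor :: "nat \<Rightarrow> 'n::finite tensor" where
  "unit_tensor m = (\<lambda>js. if \<exists>i. js = replicate m i then 1 else 0)"

definition diagonal_tensor :: "nat \<Rightarrow> 'n::finite tensor \<Rightarrow> bool" where
  "diagonal_tensor m B \<longleftrightarrow>
     B \<in> tensors m \<and> (\<forall>js. length js = m \<and> (\<nexists>i. js = replicate m i) \<longrightarrow> B js = 0)"

text \<open>
  The product of \<open>C\<close> with a diagonal tensor \<open>B\<close>, for even \<open>m\<close>. The first index \<open>i\<^sub>1\<close> carries no
  factor, hence \<open>tl\<close>. For odd \<open>k\<close>, \<open>root k\<close> is the real \<open>k\<close>-th root, also on negative numbers.
\<close>

definition diag_prod :: "nat \<Rightarrow> 'n::finite tensor \<Rightarrow> 'n tensor \<Rightarrow> 'n tensor" where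
  "diag_prod m C B = (\<lambda>js. C js * (\<Prod>j\<leftarrow>tl js. root (m - 1) (B (replicate m j))))"

end

theory Submission
  imports Defs
begin

text \<open>
  Flipping signs entrywise turns \<open>z\<close> into a solution of the absolute value equation. If \<open>d\<^sub>j = \<plusminus>1\<close> are the diagonal
  elements of \<open>D\<close>, put \<open>x\<^sub>j = d\<^sub>j z\<^sub>j\<close>. Since \<open>m - 1\<close> is odd, the real root
  \<open>d\<^sub>j\<^sup>1\<^sup>/\<^sup>(\<^sup>m\<^sup>-\<^sup>1\<^sup>)\<close> is \<open>d\<^sub>j\<close> itself, and \<open>d\<^sub>j x\<^sub>j = z\<^sub>j\<close>; so the factors that \<open>D\<close> contributes
  to \<open>C D\<close> undo the flips, and \<open>(C D) x\<^sup>m\<^sup>-\<^sup>1 = C z\<^sup>m\<^sup>-\<^sup>1\<close> (lemma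
  \<open>tensor_apply_diag_prod\<close>). On the other hand \<open>z \<ge> 0\<close> gives \<open>\<bar>x\<bar> = z\<close>, so the absolute
  value term is \<open>I z\<^sup>m\<^sup>-\<^sup>1\<close> (lemma \<open>tensor_apply_unit\<close>), and the two equations agree.
\<close>

lemma finite_index_lists: "finite {js :: 'n::finite list. length js = k}"
  using finite_lists_length_eq[of "UNIV :: 'n set" k] by simp

lemma tensor_apply_diff:
  fixes A B :: "'n::finite tensor"
  shows "tensor_apply m (A - B) x = tensor_apply m A x - tensor_apply m B x"
  by (simp add: tensor_apply_def vec_eq_iff left_diff_distrib sum_subtractf)

lemma tensor_apply_unit:
  fixes x :: "real ^ 'n::finite"
  assumes "m \<ge> 1"
  shows "tensor_apply m (unit_tensor m) x = (\<chi> i. x $ i ^ (m - 1))"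
proof -
  obtain k where m: "m = Suc k"
    using assms by (cases m) auto
  have unit: "unit_tensor m (i # js) = (if js = replicate k i then 1 else 0)"
    for i :: 'n and js
    by (auto simp: unit_tensor_def m)
  have "(\<Sum>js | length js = k. unit_tensor m (i # js) * (\<Prod>j\<leftarrow>js. x $ j)) = x $ i ^ k" for i
  proof -
    have "(\<Sum>js | length js = k. unit_tensor m (i # js) * (\<Prod>j\<leftarrow>js. x $ j))
        = (\<Sum>js | length js = k. if js = replicate k i then \<Prod>j\<leftarrow>js. x $ j else 0)"
      by (intro sum.cong) (auto simp: unit)
    also have "\<dots> = (\<Prod>j\<leftarrow>replicate k i. x $ j)"
      by (simp add: sum.delta[OF finite_index_lists])
    finally show ?thesis
      by (simp add: prod_list_replicate)
  qed
  then show ?thesis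
    by (simp add: tensor_apply_def m)
qed

text \<open>
  Each factor \<open>x\<^sub>j\<close> of a monomial can absorb the root that the diagonal tensor attaches to the
  index \<open>j\<close>: multiplying by a diagonal tensor is a diagonal change of variables.
\<close>

lemma tensor_apply_diag_prod:
  fixes C B :: "'n::finite tensor"
  shows "tensor_apply m (diag_prod m C B) x
       = tensor_apply m C (\<chi> j. root (m - 1) (B (replicate m j)) * x $ j)"
proof -
  have "(\<Prod>j\<leftarrow>js. f j) * (\<Prod>j\<leftarrow>js. x $ j) = (\<Prod>j\<leftarrow>js. f j * x $ j)"
    for f :: "'n \<Rightarrow> real" and js
    by (induction js) (simp_all add: mult_ac)
  then show ?thesis
    by (simp add: tensor_apply_def diag_prod_def mult.assoc)
qed

theorem theorem3p9:
  fixes m :: nat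
    and A C D :: "'n::finite tensor"
    and b :: "real ^ 'n"
  assumes "m \<ge> 2" and "even m"
    and "C \<in> tensors m"
    and "diagonal_tensor m D"
    and "\<forall>i. D (replicate m i) = 1 \<or> D (replicate m i) = - 1"
    and "A = diag_prod m C D"
    and "\<exists>z :: real ^ 'n. tensor_apply m (C - unit_tensor m) z = b \<and> z \<ge> 0"
  shows "\<exists>x :: real ^ 'n. tensor_apply m A x - abs_pow_vec (m - 1) x = b"
proof -
  obtain z :: "real ^ 'n"
    where z: "tensor_apply m (C - unit_tensor m) z = b" and "z \<ge> 0"
    using assms(7) by blast
  have nonneg: "z $ j \<ge> 0" for j
    using \<open>z \<ge> 0\<close> by (simp add: less_eq_vec_def)
  define d where "d j = D (replicate m j)" for j
  have d: "d j = 1 \<or> d j = - 1" for j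
    using assms(5) by (simp add: d_def)
  define x :: "real ^ 'n" where "x = (\<chi> j. d j * z $ j)"
  have "root (m - 1) (d j) * x $ j = z $ j" for j
    using d[of j] assms(1) by (auto simp: x_def real_root_minus)
  then have "tensor_apply m A x = tensor_apply m C z"
    by (simp add: assms(6) tensor_apply_diag_prod flip: d_def)
  moreover have "\<bar>x $ j\<bar> = z $ j" for j
    using d[of j] nonneg[of j] by (auto simp: x_def)
  then have "abs_pow_vec (m - 1) x = tensor_apply m (unit_tensor m) z"
    using assms(1) by (simp add: abs_pow_vec_def tensor_apply_unit)
  ultimately have "tensor_apply m A x - abs_pow_vec (m - 1) x = b"
    using z by (simp add: tensor_apply_diff)
  then show ?thesis ..
qed

end
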